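(* Let $$P(T)=a_dT^d+a_{d-1}T^{d-1}+\cdots+a_1T\in\mathbb Z[T],$$ where $d\ge1$, $a_d>0$, all $a_i\ge0$ and $\gcd(a_d,a_{d-1},\dots,a_1)=1$, and let $\mathscr Y_P$ be the family of branches $\phi_q(t)=(t,qP(t))$, $q\in\mathbb Q_{>0}$. Then the local defect set $$\mathcal B^{\mathrm{bad}}(\mathscr Y_P):=\Bigl(\bigcap_{p\text{ prime}}\mathcal B_p^{\mathrm{vis}}(\mathscr Y_P)\Bigr)\setminus\mathcal B^{\mathrm{vis}}(\mathscr Y_P)$$ has density zero relative to $\mathcal B(\mathscr Y_P)$.
   Context: The branch locus is $\mathcal B(\mathscr Y_P)=\{\phi_q(t)\in\mathbb Z^2:q\in\mathbb Q_{>0},\ t\in\mathbb R_{>0}\}$; each of its points is $\phi_q(t)$ for a unique $(q,t)$. For $Q\in\mathbb Z^2$ and a prime $p$, $v_p(Q)=\min(v_p(Q_1),v_p(Q_2))$. A point $\phi_q(t)$ of the branch locus is globally visible if there is no $s$ with $0<s<t$ and $\phi_q(s)\in\mathbb Z^2$; it is $p$-adically visible if $v_p(\phi_q(t))\le v_p(\phi_q(s))$ for every $s$ with $0<s<t$ and $\phi_q(s)\in\mathbb Z^2$. $\mathcal B^{\mathrm{vis}}(\mathscr Y_P)$, $\mathcal B^{\mathrm{vis}}_p(\mathscr Y_P)$ are the sets of globally visible and $p$-adically visible points. A set $\mathcal S\subseteq\mathcal B(\mathscr Y_P)$ has density zero relative to $\mathcal B(\mathscr Y_P)$ if $\#\{Q\in\mathcal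 S:\max_i|Q_i|\le X\}/\#\{Q\in\mathcal B(\mathscr Y_P):\max_i|Q_i|\le X\}\to0$ as $X\to\infty$. *)

theory Defs
  imports Complex_Main "HOL-Library.Extended_Nat" "HOL-Computational_Algebra.Computational_Algebra"
begin

definition branch :: "int poly \<Rightarrow> rat \<Rightarrow> real \<Rightarrow> real \<times> real" where
  "branch P q t = (t, of_rat q * poly (map_poly of_int P) t)"

definition real_point :: "int \<times> int \<Rightarrow> real \<times> real" where
  "real_point Q = (of_int (fst Q), of_int (snd Q))"

definition branch_locus :: "int poly \<Rightarrow> (int \<times> int) set" where
  "branch_locus P = {Q. \<exists>q t. q > 0 \<and> t > 0 \<and> branch P q t = real_point Q}"

(* The convention multiplicity p 0 = 0 of the library is replaced by the value infinity. *)
definition padic_val :: "nat \<Rightarrow> int \<Rightarrow> enat" where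
  "padic_val p n = (if n = 0 then \<infinity> else enat (multiplicity (int p) n))"

definition padic_val_point :: "nat \<Rightarrow> int \<times> int \<Rightarrow> enat" where
  "padic_val_point p Q = min (padic_val p (fst Q)) (padic_val p (snd Q))"

(* Visibility of a point Q refers to its parameters (q, t). For a polynomial that is positive
   on the positive reals these are unique, so the existential quantifiers below pick out
   the only branch and the only parameter giving Q. *)
definition globally_visible :: "int poly \<Rightarrow> (int \<times> int) set" where
  "globally_visible P = {Q. \<exists>q t. q > 0 \<and> t > 0 \<and> branch P q t = real_point Q \<and>
     \<not> (\<exists>s R. 0 < s \<and> s < t \<and> branch P q s = real_point R)}"

definition padically_visible :: "nat \<Rightarrow> int poly \<Rightarrow> (int \<times> int) set" where
  "padically_visible p P = {Q. \<exists>q t. q > 0 \<and> t > 0 \<and> branch P q t = real_point Q \<and>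
     (\<forall>s R. 0 < s \<and> s < t \<and> branch P q s = real_point R \<longrightarrow>
        padic_val_point p Q \<le> padic_val_point p R)}"

definition local_defect_set :: "int poly \<Rightarrow> (int \<times> int) set" where
  "local_defect_set P = (\<Inter>p\<in>{p. prime p}. padically_visible p P) - globally_visible P"

definition points_up_to :: "(int \<times> int) set \<Rightarrow> real \<Rightarrow> (int \<times> int) set" where
  "points_up_to S X = {Q \<in> S. of_int (max \<bar>fst Q\<bar> \<bar>snd Q\<bar>) \<le> X}"

definition density_zero_relative :: "(int \<times> int) set \<Rightarrow> (int \<times> int) set \<Rightarrow> bool" where
  "density_zero_relative S B \<longleftrightarrow> S \<subseteq> B \<and>
     ((\<lambda>X. real (card (points_up_to S X)) / real (card (points_up_to B X))) \<longlongrightarrow> 0) at_top"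

end

theory Submission
  imports Defs "HOL-Analysis.Summation_Tests"
begin

text \<open>
  Since \<open>P\<close> has nonnegative coefficients and no constant term, it is positive and strictly
  increasing on the positive integers. The branch locus therefore consists of all pairs
  \<open>(n, m)\<close> of positive integers, with \<open>q = m / P n\<close>. Such a point is globally
  invisible (hidden) iff \<open>P n\<close> divides \<open>m * P s\<close> for some integer \<open>0 < s < n\<close>.

  If \<open>P\<close> is a monomial, it is \<open>T ^ d\<close> because its content is 1. For a hidden point there
  is then a prime \<open>p\<close> with \<open>p\<close> dividing \<open>n\<close> and \<open>p ^ d\<close> dividing
  \<open>m\<close>; the point \<open>(n / p, m / p ^ d)\<close> lies on the same branch and has smaller
  \<open>p\<close>-adic valuation. So no hidden point is \<open>p\<close>-adically visible for all \<open>p\<close>, and the defect set is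
  empty (\<open>local_defect_set_monomial_empty\<close>).

  If \<open>P\<close> is not a monomial, already the set of all hidden points has density zero
  (\<open>nonmonomial_hidden_density_zero\<close>). Write \<open>P s / P n = j / D\<close> in lowest terms. Then
  \<open>D\<close> divides both \<open>P n\<close> and \<open>m\<close>, and \<open>0 < j < D\<close>.

  \<^item> Large \<open>D\<close>: a polynomial of degree \<open>d\<close> and content 1 has at most \<open>d\<close> roots modulo
  \<open>D\<close> in an interval shorter than a fixed power \<open>D ^ \<delta>\<close>, by interpolation. The pairs
  \<open>(n, m)\<close> in the box of side \<open>N\<close> that belong to \<open>D\<close> number at most a constant times
  \<open>N\<^sup>2 / D ^ (1 + \<delta>)\<close>, and the sum over \<open>D > K\<close> is a small multiple of
  \<open>N\<^sup>2\<close> (\<open>large_denominators_rare\<close>).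

  \<^item> The remaining pairs \<open>(D, j)\<close> are finite in number. For each of them the solutions of
  \<open>D * P s = j * P n\<close> satisfy \<open>s + h = \<alpha> * (n + h) + O(1 / n)\<close>, where
  \<open>\<alpha> ^ d = j / D\<close> and \<open>-h\<close> is the mean of the complex roots of \<open>P\<close>. If \<open>n\<close> and
  \<open>n + g\<close> both occur infinitely often for one \<open>g\<close>, then integrality of \<open>s\<close> forces
  \<open>s + h = \<alpha> * (n + h)\<close> exactly, infinitely often. This makes \<open>P\<close> self-similar under
  a contraction towards \<open>-h\<close>, hence a power of \<open>T + h\<close>, and \<open>P 0 = 0\<close> leaves only
  monomials. So every gap \<open>g\<close> occurs finitely often and the \<open>n\<close> have density zero
  (\<open>fixed_ratio_density_zero\<close>).
\<close>

section \<open>Counting integers by blocks\<close>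

lemma card_le_of_block_bound:
  fixes S :: "int set" and L :: int
  assumes "S \<subseteq> {1..int N}" "L > 0"
    and block: "\<And>x. card {y \<in> S. x \<le> y \<and> y < x + L} \<le> d"
  shows "card S \<le> d * (nat (int N div L) + 1)"
proof -
  have "S \<subseteq> (\<Union>k\<in>{0..int N div L}. {y \<in> S. k * L \<le> y \<and> y < k * L + L})"
  proof
    fix y assume y: "y \<in> S"
    then have "1 \<le> y" "y \<le> int N" using assms(1) by auto
    then have "y div L \<in> {0..int N div L}"
      using assms(2) by (auto intro: zdiv_mono1 simp: pos_imp_zdiv_nonneg_iff)
    moreover have "(y div L) * L \<le> y" "y < (y div L) * L + L"
      using assms(2) pos_mod_bound[of L y] pos_mod_sign[of L y] div_mult_mod_eq[of y L] by linarith+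
    ultimately show "y \<in> (\<Union>k\<in>{0..int N div L}. {y \<in> S. k * L \<le> y \<and> y < k * L + L})"
      using y by blast
  qed
  moreover have "finite S" using assms(1) finite_subset by blast
  ultimately have "card S \<le> card (\<Union>k\<in>{0..int N div L}. {y \<in> S. k * L \<le> y \<and> y < k * L + L})"
    by (intro card_mono) auto
  also have "\<dots> \<le> (\<Sum>k\<in>{0..int N div L}. card {y \<in> S. k * L \<le> y \<and> y < k * L + L})"
    by (intro card_UN_le) auto
  also have "\<dots> \<le> (\<Sum>k\<in>{0..int N div L}. d)"
    using block by (intro sum_mono) auto
  also have "\<dots> = d * (nat (int N div L) + 1)"
    using assms(2) by (simp add: nat_add_distrib pos_imp_zdiv_nonneg_iff)
  finally show ?thesis .
qed

text \<open>Outside a finite set, two elements of \<open>A\<close> are at least \<open>G\<close> apart, for any given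
  \<open>G\<close>; the upper density of \<open>A\<close> is then at most \<open>1 / G\<close>.\<close>
lemma density_zero_of_finite_shifts:
  fixes A :: "int set" and \<epsilon> :: real
  assumes fin: "\<And>g. g > 0 \<Longrightarrow> finite {n \<in> A. n + g \<in> A}" and "\<epsilon> > 0"
  shows "\<forall>\<^sub>F N in sequentially. real (card (A \<inter> {1..int N})) \<le> \<epsilon> * N"
proof -
  obtain G :: nat where G: "G > 0" "1 / G < \<epsilon> / 2"
    using assms(2) by (metis half_gt_zero nat_approx_posE of_nat_Suc zero_less_Suc)
  define F where "F = (\<Union>g\<in>{1..<int G}. {n \<in> A. n + g \<in> A})"
  have F: "finite F" unfolding F_def using fin by auto
  have "real (card F + 1) / (\<epsilon> / 2) \<le> N \<Longrightarrow> real (card (A \<inter> {1..int N})) \<le> \<epsilon> * N" for N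
  proof -
    assume N: "real (card F + 1) / (\<epsilon> / 2) \<le> N"
    define S where "S = (A - F) \<inter> {1..int N}"
    have finS: "finite S" by (simp add: S_def)
    have "card {y \<in> S. x \<le> y \<and> y < x + int G} \<le> 1" for x
    proof (rule ccontr)
      let ?T = "{y \<in> S. x \<le> y \<and> y < x + int G}"
      assume "\<not> ?thesis"
      moreover have "finite ?T" using finS by simp
      ultimately obtain u v where "u \<in> ?T" "v \<in> ?T" "u \<noteq> v"
        using card_le_Suc0_iff_eq[of ?T] by (auto simp only: One_nat_def)
      then obtain a b where ab: "a \<in> S" "b \<in> S" "a < b" "x \<le> a" "b < x + int G"
        using that[of "min u v" "max u v"] by (cases "u < v") auto
      then have "b - a \<in> {1..<int G}" "a \<in> A" "a + (b - a) \<in> A" by (auto simp: S_def)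
      then have "a \<in> F" unfolding F_def by blast
      then show False using ab S_def by blast
    qed
    then have "card S \<le> 1 * (nat (int N div int G) + 1)"
      by (intro card_le_of_block_bound) (use G in \<open>auto simp: S_def\<close>)
    then have S: "card S \<le> N div G + 1" by (simp add: nat_int flip: zdiv_int)
    have "A \<inter> {1..int N} \<subseteq> F \<union> S" unfolding S_def by auto
    then have "card (A \<inter> {1..int N}) \<le> card (F \<union> S)"
      using F finS by (intro card_mono) simp_all
    also have "\<dots> \<le> card F + card S" by (rule card_Un_le)
    finally have "real (card (A \<inter> {1..int N})) \<le> real (card F + 1) + real (N div G)" using S by linarith
    also have "\<dots> \<le> real (card F + 1) + N * (1 / G)"
      using of_nat_div_le_of_nat[of N G] by simp
    also have "\<dots> \<le> \<epsilon> / 2 * N + N * (\<epsilon> / 2)"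
      using N G assms(2) by (intro add_mono mult_left_mono) (auto simp: field_simps)
    finally show ?thesis by (simp add: mult.commute)
  qed
  moreover have "\<forall>\<^sub>F N in sequentially. real (card F + 1) / (\<epsilon> / 2) \<le> real N"
    using filterlim_real_sequentially unfolding filterlim_at_top by blast
  ultimately show ?thesis by (auto elim: eventually_mono)
qed

section \<open>Roots of a primitive polynomial modulo D\<close>

text \<open>A divided-difference form of the Vandermonde argument: if \<open>d + 1\<close> integers are roots of
  \<open>P\<close> modulo \<open>D\<close>, then \<open>D\<close> divides all coefficients of \<open>V * P\<close>, where \<open>V\<close> is the
  product of the differences of these integers. Splitting off one root \<open>c\<close> leaves a quotient whose
  values at the other roots \<open>y\<close> vanish modulo \<open>D\<close> after multiplication by
  \<open>y - c\<close>. The exponent \<open>d * d\<close> replaces the number \<open>d * (d + 1) / 2\<close> of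
  differences; only its independence of \<open>D\<close> and \<open>L\<close> matters.\<close>
lemma root_set_multiplier:
  fixes P :: "int poly" and D L :: int
  assumes "degree P \<le> d" "finite S" "card S = Suc d"
    and "\<And>x. x \<in> S \<Longrightarrow> D dvd poly P x"
    and "\<And>x y. x \<in> S \<Longrightarrow> y \<in> S \<Longrightarrow> \<bar>x - y\<bar> \<le> L" "1 \<le> L"
  shows "\<exists>V>0. V \<le> L ^ (d * d) \<and> [:D:] dvd smult V P"
  using assms
proof (induction d arbitrary: P S)
  case 0
  then obtain x where "S = {x}" by (auto simp: card_Suc_eq)
  moreover obtain c where "P = [:c:]" using 0(1) by (metis degree_eq_zeroE le_zero_eq)
  ultimately have "[:D:] dvd smult 1 P" using 0(4)[of x] by simp
  then show ?case by (intro exI[of _ 1]) simp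
next
  case (Suc d)
  obtain c S' where S: "S = insert c S'" "c \<notin> S'" "card S' = Suc d" "finite S'"
    using Suc.prems(2,3) by (metis card_Suc_eq finite_insert)
  define Q where "Q = synthetic_div P c"
  define W where "W = (\<Prod>y\<in>S'. \<bar>y - c\<bar>)"
  have PQ: "P = [:-c, 1:] * Q + [:poly P c:]"
    unfolding Q_def by (rule synthetic_div_correct'[symmetric])
  have W0: "W > 0" unfolding W_def using S by (intro prod_pos) auto
  have "W \<le> (\<Prod>y\<in>S'. L)" unfolding W_def
    using Suc.prems(5) S by (intro prod_mono) auto
  then have WL: "W \<le> L ^ Suc d" using S by simp
  have root: "D dvd poly (smult W Q) y" if y: "y \<in> S'" for y
  proof -
    have "poly P y = (y - c) * poly Q y + poly P c" by (subst PQ) (simp add: algebra_simps)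
    moreover have "D dvd poly P y" "D dvd poly P c" using Suc.prems(4) S y by auto
    ultimately have "D dvd (y - c) * poly Q y" by (metis dvd_add_left_iff)
    moreover have "y - c dvd W"
      unfolding W_def using S y by (metis abs_dvd_iff dvd_prodI)
    ultimately show ?thesis
      by (metis dvd_trans mult_dvd_mono dvd_refl poly_smult)
  qed
  have "degree (smult W Q) \<le> d"
    using Suc.prems(1) by (auto simp: Q_def degree_synthetic_div)
  then obtain V where V: "V > 0" "V \<le> L ^ (d * d)" "[:D:] dvd smult V (smult W Q)"
    using Suc.IH[of "smult W Q" S'] root S Suc.prems(5,6) by auto
  have "smult (V * W) P = [:-c, 1:] * smult V (smult W Q) + smult (V * W) [:poly P c:]"
    by (subst PQ) (simp add: smult_add_right)
  moreover have "[:D:] dvd smult (V * W) [:poly P c:]"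
    using Suc.prems(4)[of c] S by simp
  ultimately have "[:D:] dvd smult (V * W) P" using V(3) by (metis dvd_add dvd_mult)
  moreover have "V * W \<le> L ^ (Suc d * Suc d)"
  proof -
    have "V * W \<le> L ^ (d * d) * L ^ Suc d"
      using V WL W0 by (intro mult_mono) auto
    also have "\<dots> \<le> L ^ (Suc d * Suc d)"
      unfolding power_add[symmetric] using Suc.prems(6) by (intro power_increasing) auto
    finally show ?thesis .
  qed
  ultimately show ?case using V W0 by (intro exI[of _ "V * W"]) auto
qed

lemma modulus_le_of_close_roots:
  fixes P :: "int poly" and D L :: int
  assumes "content P = 1" "finite S" "card S > degree P"
    and "\<And>x. x \<in> S \<Longrightarrow> D dvd poly P x"
    and "\<And>x y. x \<in> S \<Longrightarrow> y \<in> S \<Longrightarrow> \<bar>x - y\<bar> \<le> L" "1 \<le> L"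
  shows "D \<le> L ^ (degree P * degree P)"
proof -
  obtain T where T: "T \<subseteq> S" "card T = Suc (degree P)"
    using assms(2,3) by (metis Suc_leI obtain_subset_with_card_n)
  then have "finite T" using assms(2) finite_subset by blast
  then obtain V where V: "V > 0" "V \<le> L ^ (degree P * degree P)" "[:D:] dvd smult V P"
    using root_set_multiplier[of P "degree P" T D L] T assms by blast
  then have "D dvd V" using assms(1) by (simp add: const_poly_dvd_iff_dvd_content)
  then show ?thesis using V by (meson zdvd_imp_le order_trans)
qed

text \<open>Blocks of length \<open>L = \<lceil>D powr (1 / d\<^sup>2)\<rceil>\<close> contain at most \<open>d\<close> roots each, because
  \<open>d + 1\<close> of them would lie within distance \<open>L - 1\<close> of each other, and
  \<open>(L - 1) ^ (d * d) < D\<close>. The hypothesis \<open>D \<le> N\<close> makes the number of blocks at most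
  \<open>2 * N / L\<close>.\<close>
lemma card_roots_mod_le:
  fixes P :: "int poly"
  assumes "content P = 1" "degree P \<ge> 1" "1 \<le> D" "D \<le> N"
  shows "real (card {n \<in> {1..int N}. int D dvd poly P n})
      \<le> 2 * real (degree P) * N * real D powr (- 1 / real (degree P * degree P))"
proof -
  define d where "d = degree P"
  define e where "e = 1 / real (d * d)"
  have d: "d \<ge> 1" using assms d_def by simp
  then have e: "0 < e" "e \<le> 1" unfolding e_def
    by (auto simp: divide_le_eq) (metis One_nat_def Suc_leI d mult_le_mono nat_mult_1 of_nat_1 of_nat_le_iff of_nat_mult)
  define L where "L = \<lceil>real D powr e\<rceil>"
  have Dp: "1 \<le> real D powr e" "real D powr e \<le> real D"
    using e assms(3) ge_one_powr_ge_zero powr_mono[of e 1 "real D"] by auto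
  have L: "1 \<le> L" "real D powr e \<le> L" "L - 1 < real D powr e" "L \<le> int D"
    using Dp unfolding L_def by (linarith | simp add: ceiling_le_iff)+
  define S where "S = {n \<in> {1..int N}. int D dvd poly P n}"
  have "card {y \<in> S. x \<le> y \<and> y < x + L} \<le> d" for x
  proof (rule ccontr)
    assume *: "\<not> ?thesis"
    show False
    proof (cases "L = 1")
      \<comment> \<open>The root bound needs a positive distance \<open>L - 1\<close>; a block of length 1 is a single point.\<close>
      case True
      have "{y \<in> S. x \<le> y \<and> y < x + L} \<subseteq> {x}" using True by auto
      then have "card {y \<in> S. x \<le> y \<and> y < x + L} \<le> 1"
        using card_mono[of "{x}"] by fastforce
      then show False using * d by linarith
    next
      case False
      have "int D \<le> (L - 1) ^ (d * d)"
        unfolding d_def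
        by (rule modulus_le_of_close_roots[OF assms(1), of "{y \<in> S. x \<le> y \<and> y < x + L}"])
          (use * False L in \<open>auto simp: S_def d_def\<close>)
      then have "real D \<le> real_of_int (L - 1) ^ (d * d)"
        by (metis of_int_le_iff of_int_of_nat_eq of_int_power)
      also have "\<dots> < (real D powr e) ^ (d * d)"
        using L d by (intro power_strict_mono) auto
      also have "\<dots> = real D"
        using assms(3) d unfolding e_def by (simp add: powr_power)
      finally show False by simp
    qed
  qed
  then have "card S \<le> d * (nat (int N div L) + 1)"
    by (intro card_le_of_block_bound) (use L in \<open>auto simp: S_def\<close>)
  then have "real (card S) \<le> real d * (real (nat (int N div L)) + 1)"
    by (metis of_nat_1 of_nat_add of_nat_le_iff of_nat_mult)
  also have "\<dots> \<le> real d * (2 * N / L)"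
  proof (intro mult_left_mono)
    have "real (nat (int N div L)) = of_int (int N div L)" using L by (simp add: pos_imp_zdiv_nonneg_iff)
    also have "\<dots> \<le> real N / L" using real_of_int_div4[of "int N" L] by simp
    finally have "real (nat (int N div L)) \<le> real N / L" .
    moreover have "1 \<le> real N / L" using L assms(4) by (simp add: le_divide_eq)
    ultimately show "real (nat (int N div L)) + 1 \<le> 2 * N / L" by simp
  qed simp
  also have "\<dots> \<le> real d * (2 * N / (real D powr e))"
    using L Dp by (intro mult_left_mono divide_left_mono) auto
  also have "\<dots> = 2 * d * N * real D powr (- e)" by (simp add: powr_minus field_simps)
  finally show ?thesis by (simp add: S_def d_def e_def)
qed

lemma card_multiples_le:
  assumes "D \<ge> 1"
  shows "real (card {m \<in> {1..int N}. int D dvd m}) \<le> N / D"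
proof -
  have "{m \<in> {1..int N}. int D dvd m} \<subseteq> (\<lambda>k. int D * k) ` {1..int N div int D}"
  proof
    fix m assume m: "m \<in> {m \<in> {1..int N}. int D dvd m}"
    then obtain k where k: "m = int D * k" by auto
    have "0 < int D * k" using m k by simp
    then have "k > 0" using assms by (metis zero_less_mult_pos of_nat_0_less_iff less_le_trans zero_less_one)
    then have "k \<ge> 1" by simp
    moreover have "k \<le> int N div int D"
      using m k assms zdiv_mono1[of "int D * k" "int N" "int D"] by simp
    ultimately have "k \<in> {1..int N div int D}" by simp
    with k show "m \<in> (\<lambda>k. int D * k) ` {1..int N div int D}" by blast
  qed
  then have "card {m \<in> {1..int N}. int D dvd m} \<le> card {1..int N div int D}"
    by (meson card_image_le card_mono finite_atLeastAtMost_int finite_imageI order_trans)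
  also have "\<dots> = N div D" by (simp flip: zdiv_int)
  finally have "real (card {m \<in> {1..int N}. int D dvd m}) \<le> real (N div D)" by simp
  also have "\<dots> \<le> N / D" by (rule of_nat_div_le_of_nat)
  finally show ?thesis .
qed

text \<open>The exponent gained in the bound on roots modulo \<open>D\<close> turns the divergent sum over
  \<open>1 / D\<close> into a convergent one, and the bound is uniform in \<open>N\<close>.\<close>
lemma large_denominators_rare:
  fixes P :: "int poly" and \<epsilon> :: real
  assumes "content P = 1" "degree P \<ge> 1" "\<epsilon> > 0"
  obtains K where "\<And>N. real (card (\<Union>D\<in>{K<..N}.
      {n \<in> {1..int N}. int D dvd poly P n} \<times> {m \<in> {1..int N}. int D dvd m})) \<le> \<epsilon> * (real N)\<^sup>2"
proof -
  define d where "d = degree P"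
  define f where "f = (\<lambda>D. real D powr (- 1 - 1 / real (d * d)))"
  have d: "d \<ge> 1" using assms d_def by simp
  have "summable f" unfolding f_def summable_real_powr_iff using d by simp
  then obtain K where K: "\<And>m n. m \<ge> K \<Longrightarrow> norm (sum f {m..<n}) < \<epsilon> / (2 * d)"
    unfolding summable_Cauchy using d assms(3) by (meson divide_pos_pos of_nat_0_less_iff mult_pos_pos zero_less_numeral less_le_trans zero_less_one)
  show thesis
  proof
    fix N
    let ?A = "\<lambda>D. {n \<in> {1..int N}. int D dvd poly P n}"
    let ?B = "\<lambda>D. {m \<in> {1..int N}. int D dvd m}"
    have "real (card (\<Union>D\<in>{K<..N}. ?A D \<times> ?B D)) \<le> real (\<Sum>D\<in>{K<..N}. card (?A D \<times> ?B D))"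
      by (intro of_nat_mono card_UN_le) simp
    also have "\<dots> = (\<Sum>D\<in>{K<..N}. real (card (?A D)) * real (card (?B D)))"
      by (simp add: card_cartesian_product)
    also have "\<dots> \<le> (\<Sum>D\<in>{K<..N}. 2 * d * (real N)\<^sup>2 * f D)"
    proof (intro sum_mono)
      fix D assume D: "D \<in> {K<..N}"
      then have "1 \<le> D" "D \<le> N" by auto
      then have "real (card (?A D)) * real (card (?B D))
          \<le> (2 * real d * N * real D powr (- 1 / real (d * d))) * (N / D)"
        using card_roots_mod_le[OF assms(1,2)] card_multiples_le unfolding d_def
        by (intro mult_mono) auto
      also have "\<dots> = 2 * d * (real N)\<^sup>2 * f D"
        using \<open>1 \<le> D\<close> unfolding f_def by (simp add: powr_diff powr_minus power2_eq_square field_simps)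
      finally show "real (card (?A D)) * real (card (?B D)) \<le> 2 * d * (real N)\<^sup>2 * f D" .
    qed
    also have "\<dots> = 2 * d * (real N)\<^sup>2 * sum f {Suc K..<Suc N}"
      by (simp add: sum_distrib_left atLeastLessThanSuc_atLeastAtMost atLeastSucAtMost_greaterThanAtMost)
    also have "\<dots> \<le> 2 * d * (real N)\<^sup>2 * (\<epsilon> / (2 * d))"
      using K[of "Suc K" "Suc N"] by (intro mult_left_mono) auto
    also have "\<dots> = \<epsilon> * (real N)\<^sup>2" using d by simp
    finally show "real (card (\<Union>D\<in>{K<..N}. ?A D \<times> ?B D)) \<le> \<epsilon> * (real N)\<^sup>2" .
  qed
qed

section \<open>Pairs with a prescribed ratio of values\<close>

lemma poly_bound_by_power:
  fixes R :: "real poly"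
  assumes "degree R \<le> e"
  obtains C where "C \<ge> 0" "\<And>x. x \<ge> 1 \<Longrightarrow> \<bar>poly R x\<bar> \<le> C * x ^ e"
proof
  show "0 \<le> (\<Sum>i\<le>degree R. \<bar>coeff R i\<bar>)" by (intro sum_nonneg) auto
  fix x :: real assume x: "x \<ge> 1"
  have "\<bar>poly R x\<bar> \<le> (\<Sum>i\<le>degree R. \<bar>coeff R i * x ^ i\<bar>)"
    unfolding poly_altdef by (rule sum_abs)
  also have "\<dots> \<le> (\<Sum>i\<le>degree R. \<bar>coeff R i\<bar> * x ^ e)"
    using x assms by (intro sum_mono) (auto simp: abs_mult intro!: mult_left_mono power_increasing)
  finally show "\<bar>poly R x\<bar> \<le> (\<Sum>i\<le>degree R. \<bar>coeff R i\<bar>) * x ^ e"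
    by (simp add: sum_distrib_right)
qed

text \<open>The shift \<open>h\<close> is chosen to match the coefficient of degree \<open>d - 1\<close>, so the error drops by
  two degrees. This is what makes the deviation from the line below tend to zero rather than just
  stay bounded.\<close>
lemma poly_approx_shifted_power:
  fixes p :: "real poly"
  assumes "degree p \<ge> 2"
  defines "h \<equiv> coeff p (degree p - 1) / (degree p * lead_coeff p)"
  obtains C where "C \<ge> 0"
    "\<And>x. x \<ge> 1 \<Longrightarrow> \<bar>poly p x - lead_coeff p * (x + h) ^ degree p\<bar> \<le> C * x ^ (degree p - 2)"
proof -
  define d where "d = degree p"
  define R where "R = p - smult (lead_coeff p) ([:h, 1:] ^ d)"
  have d: "d \<ge> 2" "lead_coeff p \<noteq> 0" using assms(1) d_def by auto
  have "coeff R i = 0" if i: "i > d - 2" for i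
  proof (cases "i > d")
    case True
    moreover have "degree ([:h, 1:] ^ d) = d" by (simp add: degree_linear_power)
    ultimately show ?thesis by (simp add: R_def coeff_eq_0 d_def)
  next
    case False
    then have "i = d \<or> i = d - 1" using i by linarith
    then show ?thesis
    proof
      assume "i = d - 1"
      moreover have "d choose (d - 1) = d" using d by (cases d) (auto)
      ultimately show ?thesis using d
        by (simp add: R_def coeff_linear_poly_power h_def flip: d_def)
    qed (simp add: R_def coeff_linear_power, simp add: d_def)
  qed
  then have "degree R \<le> d - 2" by (intro degree_le) auto
  then obtain C where "C \<ge> 0" "\<And>x. x \<ge> 1 \<Longrightarrow> \<bar>poly R x\<bar> \<le> C * x ^ (d - 2)"
    using poly_bound_by_power by blast
  then show thesis using that unfolding R_def d_def by (simp add: add.commute)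
qed

lemma abs_diff_power_ge:
  fixes u v :: real
  assumes "u \<ge> 0" "v \<ge> 0" "d \<ge> 1"
  shows "\<bar>u - v\<bar> * v ^ (d - 1) \<le> \<bar>u ^ d - v ^ d\<bar>"
proof -
  obtain k where k: "d = Suc k" using assms(3) by (cases d) auto
  have "v ^ k \<le> (\<Sum>p<Suc k. u ^ p * v ^ (k - p))"
    using assms by (subst sum.lessThan_Suc_shift) (auto intro!: sum_nonneg)
  then have "\<bar>u - v\<bar> * v ^ k \<le> \<bar>u - v\<bar> * \<bar>\<Sum>p<Suc k. u ^ p * v ^ (k - p)\<bar>"
    by (intro mult_left_mono) auto
  then show ?thesis unfolding k power_diff_sumr2[of u "Suc k" v] abs_mult
    by (simp add: mult.commute algebra_simps)
qed

text \<open>Both values of \<open>p\<close> are \<open>d\<close>-th powers up to \<open>O(x ^ (d - 2))\<close>. Taking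
  \<open>d\<close>-th roots divides the error by \<open>x ^ (d - 1)\<close>.\<close>
lemma ratio_solutions_near_line:
  fixes p :: "real poly" and \<kappa> \<mu> \<alpha> :: real
  assumes "degree p \<ge> 2" "lead_coeff p > 0" "coeff p (degree p - 1) \<ge> 0"
    and "\<kappa> > 0" "\<alpha> > 0" "\<mu> = \<kappa> * \<alpha> ^ degree p"
  defines "h \<equiv> coeff p (degree p - 1) / (degree p * lead_coeff p)"
  obtains C where "C \<ge> 0" "\<And>x y. 1 \<le> y \<Longrightarrow> y \<le> x \<Longrightarrow> \<kappa> * poly p y = \<mu> * poly p x \<Longrightarrow>
      \<bar>(y + h) - \<alpha> * (x + h)\<bar> \<le> C / x"
proof -
  define d where "d = degree p"
  define c where "c = lead_coeff p"
  obtain C where C: "C \<ge> 0"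
    "\<And>x. x \<ge> 1 \<Longrightarrow> \<bar>poly p x - c * (x + h) ^ d\<bar> \<le> C * x ^ (d - 2)"
    using poly_approx_shifted_power[OF assms(1)] unfolding h_def d_def c_def by blast
  have d: "d \<ge> 2" and c: "c > 0" and h: "h \<ge> 0" using assms by (auto simp: d_def c_def h_def)
  have \<mu>: "\<mu> > 0" using assms by simp
  define C' where "C' = (\<kappa> + \<mu>) * C / (\<kappa> * c * \<alpha> ^ (d - 1))"
  show thesis
  proof
    show "C' \<ge> 0" using C c assms \<mu> unfolding C'_def by simp
    fix x y :: real
    assume y: "1 \<le> y" "y \<le> x" and eq: "\<kappa> * poly p y = \<mu> * poly p x"
    define u where "u = y + h"
    define v where "v = \<alpha> * (x + h)"
    have uv: "u \<ge> 0" "v \<ge> 0" "\<alpha> * x \<le> v" using y h assms by (auto simp: u_def v_def)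
    have "\<kappa> * c * (u ^ d - v ^ d) = \<mu> * (poly p x - c * (x + h) ^ d) - \<kappa> * (poly p y - c * (y + h) ^ d)"
    proof -
      have "v ^ d = \<alpha> ^ d * (x + h) ^ d" by (simp add: v_def power_mult_distrib)
      moreover have "\<kappa> * poly p y = \<kappa> * \<alpha> ^ d * poly p x" "\<mu> = \<kappa> * \<alpha> ^ d"
        using eq assms(6) by (simp_all add: d_def)
      ultimately show ?thesis unfolding u_def by (simp only: right_diff_distrib) (simp add: mult_ac)
    qed
    then have "\<kappa> * c * \<bar>u ^ d - v ^ d\<bar> = \<bar>\<mu> * (poly p x - c * (x + h) ^ d) - \<kappa> * (poly p y - c * (y + h) ^ d)\<bar>"
      using c assms(4) by (metis abs_mult abs_of_pos)
    also have "\<dots> \<le> \<mu> * \<bar>poly p x - c * (x + h) ^ d\<bar> + \<kappa> * \<bar>poly p y - c * (y + h) ^ d\<bar>"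
      using \<mu> assms(4) abs_triangle_ineq4 by (metis abs_mult abs_of_pos)
    also have "\<dots> \<le> \<mu> * (C * x ^ (d - 2)) + \<kappa> * (C * y ^ (d - 2))"
      using C(2) y \<mu> assms(4) by (intro add_mono mult_left_mono) auto
    also have "\<dots> \<le> \<mu> * (C * x ^ (d - 2)) + \<kappa> * (C * x ^ (d - 2))"
      using C(1) y \<mu> assms(4) by (intro add_mono mult_left_mono power_mono) auto
    finally have 1: "\<kappa> * c * \<bar>u ^ d - v ^ d\<bar> \<le> (\<kappa> + \<mu>) * C * x ^ (d - 2)"
      by (simp add: algebra_simps)
    have "\<bar>u - v\<bar> * (\<alpha> * x) ^ (d - 1) \<le> \<bar>u - v\<bar> * v ^ (d - 1)"
      using uv y assms by (intro mult_left_mono power_mono) auto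
    also have "\<dots> \<le> \<bar>u ^ d - v ^ d\<bar>" using uv d by (intro abs_diff_power_ge) auto
    finally have "\<kappa> * c * (\<bar>u - v\<bar> * (\<alpha> * x) ^ (d - 1)) \<le> \<kappa> * c * \<bar>u ^ d - v ^ d\<bar>"
      using c assms(4) by (intro mult_left_mono) auto
    also note 1
    also have "(\<alpha> * x) ^ (d - 1) = \<alpha> ^ (d - 1) * x * x ^ (d - 2)"
    proof -
      have "d - 1 = Suc (d - 2)" using d by simp
      then show ?thesis by (simp add: power_mult_distrib)
    qed
    finally have "(\<bar>u - v\<bar> * x * (\<kappa> * c * \<alpha> ^ (d - 1))) * x ^ (d - 2) \<le> ((\<kappa> + \<mu>) * C) * x ^ (d - 2)"
      by (simp add: algebra_simps)
    then have "\<bar>u - v\<bar> * x * (\<kappa> * c * \<alpha> ^ (d - 1)) \<le> (\<kappa> + \<mu>) * C"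
      using y by (simp add: mult_le_cancel_right)
    then have "\<bar>u - v\<bar> * x \<le> C'"
      unfolding C'_def using c assms(4,5) by (subst pos_le_divide_eq) auto
    then show "\<bar>(y + h) - \<alpha> * (x + h)\<bar> \<le> C' / x"
      using y by (simp add: pos_le_divide_eq u_def v_def)
  qed
qed

text \<open>After recentring at the fixed point \<open>-h\<close> of the affine map, the coefficient of degree
  \<open>i\<close> is multiplied by \<open>\<alpha> ^ i\<close> and must be multiplied by \<open>\<alpha> ^ degree p\<close>, so
  only the leading one survives. Then \<open>p\<close> is a multiple of \<open>(x + h) ^ degree p\<close>, and the zero at
  the origin forces \<open>h = 0\<close>.\<close>
lemma monom_of_affine_self_similarity:
  fixes p :: "real poly" and \<kappa> \<mu> \<alpha> h :: real
  assumes "degree p \<ge> 1" "0 < \<alpha>" "\<alpha> < 1" "\<kappa> > 0" "\<mu> = \<kappa> * \<alpha> ^ degree p" "poly p 0 = 0"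
    and inf: "infinite {x. \<kappa> * poly p (\<alpha> * (x + h) - h) = \<mu> * poly p x}"
  shows "p = monom (lead_coeff p) (degree p)"
proof -
  define d where "d = degree p"
  define q where "q = pcompose p [:-h, 1:]"
  have pq: "p = pcompose q [:h, 1:]"
    unfolding q_def by (simp add: pcompose_pCons flip: pcompose_assoc)
  have dq: "degree q = d" unfolding q_def d_def by (simp add: degree_pcompose)
  define r where "r = smult \<kappa> (pcompose p [:\<alpha> * h - h, \<alpha>:]) - smult \<mu> p"
  have "infinite {x. poly r x = 0}"
    using inf unfolding r_def by (simp add: poly_pcompose algebra_simps)
  then have "r = 0" using poly_roots_finite by blast
  then have r: "poly r x = 0" for x by simp
  have "poly (smult \<kappa> (pcompose q [:0, \<alpha>:])) y = poly (smult \<mu> q) y" for y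
    using r[of "y - h"] unfolding r_def q_def
    by (simp add: poly_pcompose algebra_simps)
  then have "smult \<kappa> (pcompose q [:0, \<alpha>:]) = smult \<mu> q"
    by (simp add: poly_eq_poly_eq_iff[symmetric] fun_eq_iff)
  then have "\<kappa> * (\<alpha> ^ i * coeff q i) = \<mu> * coeff q i" for i
    by (metis coeff_pcompose_linear coeff_smult)
  then have "coeff q i = 0 \<or> \<alpha> ^ i = \<alpha> ^ d" for i
    using assms(4,5) unfolding d_def by auto
  then have "coeff q i = 0" if "i \<noteq> d" for i
    using that assms(2,3) by (metis power_inject_exp' less_irrefl)
  then have q: "q = monom (coeff q d) d" by (auto simp: poly_eq_iff)
  have cd: "coeff q d \<noteq> 0" using dq assms(1) d_def by (metis leading_coeff_0_iff degree_0 not_one_le_zero)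
  have "poly q h = 0" using assms(6) by (subst (asm) pq) (simp add: poly_pcompose)
  then have "coeff q d * h ^ d = 0" by (subst (asm) q) (simp add: poly_monom)
  then have "h = 0" using cd by simp
  then have "p = q" unfolding q_def by (simp add: pcompose_idR)
  then show ?thesis using q d_def by metis
qed

lemma integers_isolated_from_real:
  fixes r :: real
  obtains \<eta> where "\<eta> > 0" "\<And>z::int. \<bar>of_int z - r\<bar> < \<eta> \<Longrightarrow> of_int z = r"
proof (cases "r \<in> \<int>")
  case True
  then obtain k where "r = of_int k" by (auto elim: Ints_cases)
  then show thesis by (intro that[of 1]) auto
next
  case False
  then have "frac r > 0" "frac r < 1" by (auto simp: frac_gt_0_iff frac_lt_1)
  show thesis
  proof (rule that[of "min (frac r) (1 - frac r)"])
    fix z :: int assume z: "\<bar>of_int z - r\<bar> < min (frac r) (1 - frac r)"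
    then have "of_int z > real_of_int \<lfloor>r\<rfloor>" "of_int z < real_of_int \<lfloor>r\<rfloor> + 1"
      unfolding frac_def by linarith+
    then have "z > \<lfloor>r\<rfloor>" "z < \<lfloor>r\<rfloor> + 1" by linarith+
    then show "of_int z = r" by linarith
  qed (use \<open>frac r > 0\<close> \<open>frac r < 1\<close> in auto)
qed

text \<open>For large \<open>n\<close> with \<open>n\<close> and \<open>n + g\<close> in \<open>A\<close>, the integer
  \<open>s (n + g) - s n\<close> is so close to \<open>\<alpha> * g\<close> that they coincide. So either no such
  large \<open>n\<close> exists, or \<open>\<alpha> * g\<close> is an integer; in the latter case the deviations
  \<open>s n + h - \<alpha> * (n + h)\<close> lie in a translate of the multiples of \<open>1 / g\<close>, and those tending
  to zero are eventually zero.\<close>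
lemma finite_pairs_near_line:
  fixes A :: "int set" and s :: "int \<Rightarrow> int" and \<alpha> h C :: real
  assumes pos: "\<And>n. n \<in> A \<Longrightarrow> n > 0"
    and near: "\<And>n. n \<in> A \<Longrightarrow> \<bar>(s n + h) - \<alpha> * (n + h)\<bar> \<le> C / n"
    and off: "finite {n \<in> A. s n + h = \<alpha> * (n + h)}"
    and "C \<ge> 0" "g > 0"
  shows "finite {n \<in> A. n + g \<in> A}"
proof -
  obtain \<eta> where \<eta>: "\<eta> > 0" "\<And>z::int. \<bar>of_int z - \<alpha> * g\<bar> < \<eta> \<Longrightarrow> of_int z = \<alpha> * g"
    using integers_isolated_from_real by blast
  obtain M where M: "2 * C / \<eta> < real_of_int M" using ex_less_of_int by blast
  have step: "s (n + g) - s n = \<alpha> * g" if n: "n \<in> A" "n + g \<in> A" "n > M" for n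
  proof (rule \<eta>(2))
    have n0: "n > 0" using pos n by auto
    have "\<bar>of_int (s (n + g) - s n) - \<alpha> * g\<bar> \<le> C / (n + g) + C / n"
      using near[OF n(1)] near[OF n(2)] by (simp add: algebra_simps abs_le_iff)
    also have "\<dots> \<le> C / n + C / n"
      using n0 assms(4,5) by (intro add_right_mono divide_left_mono) auto
    also have "\<dots> = 2 * C / n" by simp
    also have "\<dots> < \<eta>"
    proof -
      have "2 * C / \<eta> < n" using M n(3) by linarith
      then show ?thesis using n0 \<eta>(1) by (simp add: field_simps)
    qed
    finally show "\<bar>of_int (s (n + g) - s n) - \<alpha> * g\<bar> < \<eta>" .
  qed
  show ?thesis
  proof (cases "\<exists>e::int. of_int e = \<alpha> * g")
    case False
    then have "\<not> n > M" if "n \<in> A" "n + g \<in> A" for n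
      using step that by metis
    then have "{n \<in> A. n + g \<in> A} \<subseteq> {0..M}"
      using pos by (fastforce simp: not_less)
    then show ?thesis using finite_subset by blast
  next
    case True
    then obtain e :: int where e: "of_int e = \<alpha> * g" by blast
    \<comment> \<open>Multiplied by \<open>g\<close>, the deviation of \<open>n\<close> becomes an integer minus the constant \<open>r\<close>.\<close>
    define r where "r = (of_int e - of_int g) * h"
    obtain \<zeta> where \<zeta>: "\<zeta> > 0" "\<And>z::int. \<bar>of_int z - r\<bar> < \<zeta> \<Longrightarrow> of_int z = r"
      using integers_isolated_from_real by blast
    obtain M' where M': "C * g / \<zeta> < real_of_int M'" using ex_less_of_int by blast
    have on: "s n + h = \<alpha> * (n + h)" if n: "n \<in> A" "n > M'" for n
    proof -
      have n0: "n > 0" using pos n by auto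
      have lin: "of_int (g * s n - e * n) - r = g * ((s n + h) - \<alpha> * (n + h))"
        using e by (simp add: r_def algebra_simps)
      then have "\<bar>of_int (g * s n - e * n) - r\<bar> = g * \<bar>(s n + h) - \<alpha> * (n + h)\<bar>"
        using assms(5) by (simp add: abs_mult)
      also have "\<dots> \<le> g * (C / n)" using near[OF n(1)] assms(5) by (intro mult_left_mono) auto
      also have "\<dots> < \<zeta>"
      proof -
        have "C * g / \<zeta> < n" using M' n(2) by linarith
        then show ?thesis using n0 \<zeta>(1) by (simp add: field_simps)
      qed
      finally have "of_int (g * s n - e * n) = r" by (rule \<zeta>(2))
      then show ?thesis using lin assms(5) by simp
    qed
    have "{n \<in> A. n + g \<in> A} \<subseteq> {0..M'} \<union> {n \<in> A. s n + h = \<alpha> * (n + h)}"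
    proof
      fix n assume "n \<in> {n \<in> A. n + g \<in> A}"
      then show "n \<in> {0..M'} \<union> {n \<in> A. s n + h = \<alpha> * (n + h)}"
        using on[of n] pos[of n] by (cases "n > M'") auto
    qed
    then show ?thesis using off finite_subset by blast
  qed
qed

lemma poly_map_poly_of_int:
  "poly (map_poly of_int P) (of_int x :: real) = of_int (poly P x)"
  by (induction P) (simp_all add: map_poly_pCons)

text \<open>If infinitely many solutions lay exactly on the limiting line, \<open>P\<close> would be self-similar
  and therefore a monomial. Hence only finitely many do, and every gap between solutions occurs
  finitely often.\<close>
lemma fixed_ratio_density_zero:
  fixes P :: "int poly" and D j :: int
  assumes "degree P \<ge> 2" "lead_coeff P > 0" "\<And>i. coeff P i \<ge> 0" "coeff P 0 = 0"
    and nonmonom: "P \<noteq> monom (lead_coeff P) (degree P)"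
    and "0 < j" "j < D" "\<epsilon> > (0::real)"
  shows "\<forall>\<^sub>F N in sequentially.
    real (card ({n. \<exists>s. 0 < s \<and> s < n \<and> D * poly P s = j * poly P n} \<inter> {1..int N})) \<le> \<epsilon> * N"
proof (rule density_zero_of_finite_shifts)
  define A where "A = {n. \<exists>s. 0 < s \<and> s < n \<and> D * poly P s = j * poly P n}"
  define p where "p = map_poly real_of_int P"
  have poly_p: "poly p (of_int x) = of_int (poly P x)" for x
    unfolding p_def by (rule poly_map_poly_of_int)
  have coeff_p: "coeff p i = of_int (coeff P i)" for i by (simp add: p_def coeff_map_poly)
  have deg_p: "degree p = degree P" unfolding p_def by (intro degree_map_poly) simp
  define d where "d = degree p"
  define \<alpha> where "\<alpha> = root d (j / D)"
  have d: "d \<ge> 2" using assms(1) deg_p d_def by simp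
  have \<alpha>: "0 < \<alpha>" "\<alpha> < 1" "\<alpha> ^ d = j / D"
    unfolding \<alpha>_def using assms(6,7) d by (auto simp: real_root_lt_1_iff)
  have \<mu>: "real_of_int j = D * \<alpha> ^ degree p" using \<alpha> assms(6,7) d_def by simp
  define h where "h = coeff p (degree p - 1) / (degree p * lead_coeff p)"
  obtain C where C: "C \<ge> 0" "\<And>x y. 1 \<le> y \<Longrightarrow> y \<le> x \<Longrightarrow> D * poly p y = j * poly p x \<Longrightarrow>
      \<bar>(y + h) - \<alpha> * (x + h)\<bar> \<le> C / x"
  proof (rule ratio_solutions_near_line[of p "real_of_int D" \<alpha> "real_of_int j"])
    show "degree p \<ge> 2" "lead_coeff p > 0" "coeff p (degree p - 1) \<ge> 0" "real_of_int D > 0"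
      using d assms by (auto simp: d_def coeff_p deg_p)
  qed (use \<alpha> \<mu> in \<open>simp_all add: h_def\<close>)
  have "\<forall>n\<in>A. \<exists>s. 0 < s \<and> s < n \<and> D * poly P s = j * poly P n" unfolding A_def by blast
  then obtain s where s: "\<And>n. n \<in> A \<Longrightarrow> 0 < s n \<and> s n < n \<and> D * poly P (s n) = j * poly P n"
    by metis
  have seq: "D * poly p (s n) = j * poly p n" if "n \<in> A" for n
    using s[OF that] by (metis poly_p of_int_mult)
  have "finite {n \<in> A. s n + h = \<alpha> * (n + h)}"
  proof (rule ccontr)
    assume inf: "infinite {n \<in> A. s n + h = \<alpha> * (n + h)}"
    have "real_of_int ` {n \<in> A. s n + h = \<alpha> * (n + h)}
        \<subseteq> {x. D * poly p (\<alpha> * (x + h) - h) = j * poly p x}"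
    proof clarify
      fix n assume "n \<in> A" "s n + h = \<alpha> * (n + h)"
      then have "s n = \<alpha> * (n + h) - h" by simp
      then show "D * poly p (\<alpha> * (n + h) - h) = j * poly p n" using seq[OF \<open>n \<in> A\<close>] by simp
    qed
    moreover have "infinite (real_of_int ` {n \<in> A. s n + h = \<alpha> * (n + h)})"
      using inf by (subst finite_image_iff) (auto simp: inj_on_def)
    ultimately have "infinite {x. D * poly p (\<alpha> * (x + h) - h) = j * poly p x}"
      using finite_subset by blast
    moreover have "poly p 0 = 0" using assms(4) by (simp add: poly_0_coeff_0 coeff_p)
    ultimately have "p = monom (lead_coeff p) (degree p)"
      using d \<alpha> \<mu> assms(6,7)
      by (intro monom_of_affine_self_similarity[of p \<alpha> "real_of_int D" "real_of_int j" h])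
        (simp_all add: d_def)
    then have coeffs: "coeff P i = (if degree P = i then lead_coeff P else 0)" for i
      using coeff_p deg_p by (metis coeff_monom of_int_eq_0_iff)
    have "P = monom (lead_coeff P) (degree P)"
      by (rule poly_eqI, unfold coeff_monom, rule coeffs)
    then show False using nonmonom by blast
  qed
  moreover have "\<bar>(s n + h) - \<alpha> * (n + h)\<bar> \<le> C / n" if "n \<in> A" for n
    using s[OF that] seq[OF that] by (intro C(2)) auto
  moreover have "n > 0" if "n \<in> A" for n using s[OF that] by simp
  ultimately show "finite {n \<in> {n. \<exists>s. 0 < s \<and> s < n \<and> D * poly P s = j * poly P n}.
      n + g \<in> {n. \<exists>s. 0 < s \<and> s < n \<and> D * poly P s = j * poly P n}}" if "g > 0" for g
    using finite_pairs_near_line[of A s h \<alpha> C g] C(1) that unfolding A_def by blast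
qed (fact assms)

section \<open>Hidden points of a family that is not monomial\<close>

lemma poly_strict_mono_nonneg_coeffs:
  fixes P :: "int poly"
  assumes "degree P \<ge> 1" "lead_coeff P > 0" "\<And>i. coeff P i \<ge> 0" "0 \<le> x" "x < y"
  shows "poly P x < poly P y"
  unfolding poly_altdef
proof (rule sum_strict_mono_ex1)
  show "\<exists>i\<in>{..degree P}. coeff P i * x ^ i < coeff P i * y ^ i"
    using assms by (intro bexI[of _ "degree P"]) (auto intro!: power_strict_mono)
qed (use assms in \<open>auto intro!: mult_left_mono power_mono\<close>)

text \<open>Here \<open>j / D\<close> is \<open>P s / P n\<close> in lowest terms. It lies strictly between 0 and 1 by
  monotonicity, and coprimality moves the divisibility from \<open>m * j\<close> to \<open>m\<close>.\<close>
lemma hidden_denominator: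
  fixes P :: "int poly"
  assumes "degree P \<ge> 1" "lead_coeff P > 0" "\<And>i. coeff P i \<ge> 0" "coeff P 0 = 0"
    and "0 < s" "s < n" "poly P n dvd m * poly P s"
  obtains D j where "1 < D" "0 < j" "j < D" "D dvd m" "D dvd poly P n"
    "D * poly P s = j * poly P n"
proof -
  have P0: "poly P 0 = 0" using assms(4) by (simp add: poly_0_coeff_0)
  have pos: "0 < poly P s" "poly P s < poly P n"
    using poly_strict_mono_nonneg_coeffs[OF assms(1-3), of 0 s] poly_strict_mono_nonneg_coeffs[OF assms(1-3), of s n]
      P0 assms(5,6) by auto
  define c where "c = gcd (poly P n) (poly P s)"
  have c: "c > 0" using pos by (simp add: c_def)
  obtain D j where Dj: "poly P n = D * c" "poly P s = j * c" "coprime D j"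
    unfolding c_def using gcd_coprime_exists[of "poly P n" "poly P s"] pos by auto
  have "0 < j" "j < D" using pos c by (auto simp: Dj zero_less_mult_iff)
  moreover have "D dvd m * j" using assms(7) c unfolding Dj by (metis dvd_mult_cancel_right less_irrefl mult.assoc)
  then have "D dvd m" using Dj(3) by (simp add: coprime_dvd_mult_left_iff)
  moreover have "D * poly P s = j * poly P n" "D dvd poly P n" by (auto simp: Dj)
  ultimately show thesis by (intro that[of D j]) auto
qed

text \<open>The threshold \<open>K\<close> is fixed first, making the contribution of all \<open>D > K\<close> at most
  \<open>\<epsilon> / 2 * N\<^sup>2\<close> for every \<open>N\<close>. Only then is \<open>N\<close> taken large, for the finitely many
  pairs \<open>(D, j)\<close> that are left. For these, all \<open>m\<close> in the box are counted.\<close>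
lemma nonmonomial_hidden_density_zero:
  fixes P :: "int poly"
  assumes "degree P \<ge> 2" "lead_coeff P > 0" "\<And>i. coeff P i \<ge> 0" "coeff P 0 = 0" "content P = 1"
    and nonmonom: "P \<noteq> monom (lead_coeff P) (degree P)" and "\<epsilon> > (0::real)"
  shows "\<forall>\<^sub>F N in sequentially. real (card {(n, m) \<in> {1..int N} \<times> {1..int N}.
    \<exists>s. 0 < s \<and> s < n \<and> poly P n dvd m * poly P s}) \<le> \<epsilon> * (real N)\<^sup>2"
proof -
  let ?A = "\<lambda>D j. {n. \<exists>s. 0 < s \<and> s < n \<and> D * poly P s = j * poly P n}"
  let ?B = "\<lambda>D N. {n \<in> {1..int N}. int D dvd poly P n} \<times> {m \<in> {1..int N}. int D dvd m}"
  obtain K where K: "\<And>N. real (card (\<Union>D\<in>{K<..N}. ?B D N)) \<le> \<epsilon> / 2 * (real N)\<^sup>2"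
    using large_denominators_rare[of P "\<epsilon> / 2"] assms(1,5,7) by auto
  define I where "I = (SIGMA D:{1..int K}. {1..<D})"
  have I: "finite I" unfolding I_def by auto
  define \<delta> where "\<delta> = \<epsilon> / (2 * (card I + 1))"
  have \<delta>: "\<delta> > 0" using assms by (simp add: \<delta>_def)
  have "\<forall>\<^sub>F N in sequentially. \<forall>(D, j)\<in>I. real (card (?A D j \<inter> {1..int N})) \<le> \<delta> * N"
    using I fixed_ratio_density_zero[OF assms(1-4) nonmonom _ _ \<delta>]
    by (intro eventually_ball_finite) (auto simp: I_def)
  then show ?thesis
  proof (rule eventually_mono)
    fix N assume N: "\<forall>(D, j)\<in>I. real (card (?A D j \<inter> {1..int N})) \<le> \<delta> * N"
    let ?E = "{(n, m) \<in> {1..int N} \<times> {1..int N}. \<exists>s. 0 < s \<and> s < n \<and> poly P n dvd m * poly P s}"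
    let ?E1 = "\<Union>(D, j)\<in>I. (?A D j \<inter> {1..int N}) \<times> {1..int N}"
    let ?E2 = "\<Union>D\<in>{K<..N}. ?B D N"
    have "?E \<subseteq> ?E1 \<union> ?E2"
    proof clarify
      fix n m s
      assume nm: "n \<in> {1..int N}" "m \<in> {1..int N}" and "(n, m) \<notin> ?E2"
        and s: "0 < s" "s < n" "poly P n dvd m * poly P s"
      obtain D j where Dj: "1 < D" "0 < j" "j < D" "D dvd m" "D dvd poly P n"
        "D * poly P s = j * poly P n"
        using hidden_denominator[OF _ assms(2-4) s] assms(1) by auto
      have "D \<le> int N" using Dj(4) nm zdvd_imp_le[of D m] by auto
      have "D \<le> int K"
      proof (rule ccontr)
        assume "\<not> ?thesis"
        then have "nat D \<in> {K<..N}" "(n, m) \<in> ?B (nat D) N"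
          using nm Dj \<open>D \<le> int N\<close> by auto
        then show False using \<open>(n, m) \<notin> ?E2\<close> by blast
      qed
      then have "(D, j) \<in> I" using Dj by (auto simp: I_def)
      moreover have "n \<in> ?A D j" using s Dj by blast
      ultimately show "(n, m) \<in> ?E1" using nm by blast
    qed
    moreover have "finite (?E1 \<union> ?E2)"
      by (rule finite_subset[of _ "{1..int N} \<times> {1..int N}"]) auto
    ultimately have "card ?E \<le> card (?E1 \<union> ?E2)" by (intro card_mono)
    also have "\<dots> \<le> card ?E1 + card ?E2" by (rule card_Un_le)
    finally have "real (card ?E) \<le> real (card ?E1) + real (card ?E2)" by linarith
    also have "real (card ?E1) \<le> real (\<Sum>(D, j)\<in>I. card ((?A D j \<inter> {1..int N}) \<times> {1..int N}))"
      using card_UN_le[OF I, of "\<lambda>(D, j). (?A D j \<inter> {1..int N}) \<times> {1..int N}"]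
      by (intro of_nat_mono) (simp add: case_prod_unfold)
    also have "\<dots> = (\<Sum>(D, j)\<in>I. real (card (?A D j \<inter> {1..int N})) * N)"
      by (simp add: card_cartesian_product case_prod_unfold)
    also have "\<dots> \<le> (\<Sum>(D, j)\<in>I. \<delta> * N * N)"
      using N by (intro sum_mono) (auto intro!: mult_right_mono)
    also have "\<dots> = (card I * \<delta>) * (real N)\<^sup>2" by (simp add: power2_eq_square)
    also have "\<dots> \<le> \<epsilon> / 2 * (real N)\<^sup>2"
      using assms(7) by (intro mult_right_mono) (auto simp: \<delta>_def field_simps)
    also note K[of N]
    finally show "real (card ?E) \<le> \<epsilon> * (real N)\<^sup>2" by simp
  qed
qed

section \<open>Lattice points on branches\<close>

lemma branch_locus_eq_quadrant:
  fixes P :: "int poly"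
  assumes pos: "\<And>n. n > 0 \<Longrightarrow> poly P n > 0"
  shows "branch_locus P = {Q. fst Q > 0 \<and> snd Q > 0}"
proof (intro set_eqI iffI)
  fix Q assume "Q \<in> branch_locus P"
  then obtain q t where q: "q > 0" "t > 0" "branch P q t = real_point Q"
    unfolding branch_locus_def by blast
  then have t: "t = of_int (fst Q)" and m: "of_int (snd Q) = of_rat q * poly (map_poly real_of_int P) t"
    by (auto simp: branch_def real_point_def)
  have "fst Q > 0" using q t by simp
  moreover have "real_of_int (snd Q) = of_rat q * of_int (poly P (fst Q))"
    using m unfolding t poly_map_poly_of_int .
  then have "real_of_int (snd Q) > 0" using q(1) pos[OF \<open>fst Q > 0\<close>] by simp
  ultimately show "Q \<in> {Q. fst Q > 0 \<and> snd Q > 0}" by simp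
next
  fix Q :: "int \<times> int" assume "Q \<in> {Q. fst Q > 0 \<and> snd Q > 0}"
  then have Q: "fst Q > 0" "snd Q > 0" by auto
  define q where "q = rat_of_int (snd Q) / of_int (poly P (fst Q))"
  have "poly P (fst Q) > 0" using pos Q by blast
  then have "branch P q (of_int (fst Q)) = real_point Q"
    by (simp add: branch_def real_point_def poly_map_poly_of_int q_def of_rat_divide)
  moreover have "q > 0" using \<open>poly P (fst Q) > 0\<close> Q by (simp add: q_def)
  moreover have "real_of_int (fst Q) > 0" using Q by simp
  ultimately show "Q \<in> branch_locus P" unfolding branch_locus_def by blast
qed

text \<open>The blocking point has the integer \<open>s\<close> as first coordinate; eliminating \<open>q\<close> between the
  two points gives the divisibility.\<close>
lemma hidden_of_not_globally_visible:
  assumes "Q \<in> branch_locus P" "Q \<notin> globally_visible P"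
  obtains s where "0 < s" "s < fst Q" "poly P (fst Q) dvd snd Q * poly P s"
proof -
  obtain q t where q: "q > 0" "t > 0" "branch P q t = real_point Q"
    using assms(1) unfolding branch_locus_def by blast
  with assms(2) obtain s R where s: "0 < s" "s < t" "branch P q s = real_point R"
    unfolding globally_visible_def by blast
  have eqs: "t = of_int (fst Q)" "of_int (snd Q) = of_rat q * real_of_int (poly P (fst Q))"
    "s = of_int (fst R)" "of_int (snd R) = of_rat q * real_of_int (poly P (fst R))"
    using q(3) s(3) by (auto simp: branch_def real_point_def simp flip: poly_map_poly_of_int)
  have "real_of_int (snd Q * poly P (fst R)) = real_of_int (poly P (fst Q) * snd R)"
    by (simp add: eqs(2,4))
  then have "snd Q * poly P (fst R) = poly P (fst Q) * snd R" by (simp only: of_int_eq_iff)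
  then have "poly P (fst Q) dvd snd Q * poly P (fst R)" by simp
  then show thesis using that[of "fst R"] s eqs by simp
qed

text \<open>Cancelling the gcd of \<open>n\<close> and \<open>s\<close> shows that \<open>n1 ^ d\<close> divides \<open>m\<close> for the
  cofactor \<open>n1 > 1\<close> of \<open>n\<close>. Any prime \<open>p\<close> dividing \<open>n1\<close> works: the point
  \<open>(n / p, m / p ^ d)\<close> is on the same branch and both its coordinates have smaller
  \<open>p\<close>-adic valuation.\<close>
lemma monomial_hidden_not_padically_visible:
  fixes d :: nat
  assumes "d \<ge> 1" "0 < m" "0 < s" "s < n" "n ^ d dvd m * s ^ d"
  shows "\<exists>p. prime p \<and> (n, m) \<notin> padically_visible p (monom 1 d)"
proof -
  define g where "g = gcd n s"
  have g: "g > 0" using assms by (simp add: g_def)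
  obtain n1 s1 where ns: "n = n1 * g" "s = s1 * g" "coprime n1 s1"
    unfolding g_def using gcd_coprime_exists[of n s] assms by auto
  have "n1 > 1" using assms g ns by (smt (verit) mult_le_cancel_right mult_pos_pos zero_less_mult_iff mult_1)
  have "n1 ^ d * g ^ d dvd (m * s1 ^ d) * g ^ d" using assms(5) by (simp add: ns power_mult_distrib mult_ac)
  then have "n1 ^ d dvd m * s1 ^ d" using g by simp
  then have "n1 ^ d dvd m" using ns(3) by (simp add: coprime_dvd_mult_left_iff)
  have "nat n1 \<noteq> 1" using \<open>n1 > 1\<close> by simp
  then obtain p where p: "prime p" "p dvd nat n1" using prime_factor_nat by blast
  have pd: "int p dvd n1" using p(2) \<open>n1 > 1\<close> by (simp add: int_dvd_int_iff[symmetric])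
  have pp: "prime (int p)" "int p > 0" using p(1) prime_gt_0_nat by auto
  obtain n2 where n2: "n = int p * n2" using pd ns by (metis dvd_def mult.assoc)
  have "int p ^ d dvd m" using pd \<open>n1 ^ d dvd m\<close> by (meson dvd_power_same dvd_trans)
  then obtain m2 where m2: "m = int p ^ d * m2" by (metis dvd_def)
  have "0 < int p * n2" "0 < int p ^ d * m2" using n2 m2 assms by simp_all
  then have pos2: "n2 > 0" "m2 > 0" using pp by (simp_all add: zero_less_mult_iff)
  have "(n, m) \<notin> padically_visible p (monom 1 d)"
  proof
    assume "(n, m) \<in> padically_visible p (monom 1 d)"
    then obtain q t where q: "t > 0" "branch (monom 1 d) q t = real_point (n, m)"
      and vis: "\<And>s R. 0 < s \<and> s < t \<and> branch (monom 1 d) q s = real_point R \<Longrightarrow>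
        padic_val_point p (n, m) \<le> padic_val_point p R"
      unfolding padically_visible_def by blast
    have t: "t = of_int n" "of_int m = of_rat q * real_of_int n ^ d"
      using q(2) by (auto simp: branch_def real_point_def map_poly_monom poly_monom)
    have "of_rat q * real_of_int n2 ^ d * real p ^ d = real_of_int m2 * real p ^ d"
      using t(2)[symmetric] by (simp add: n2 m2 power_mult_distrib mult_ac)
    then have "of_rat q * real_of_int n2 ^ d = real_of_int m2" using pp by simp
    then have "branch (monom 1 d) q (of_int n2) = real_point (n2, m2)"
      by (simp add: branch_def real_point_def map_poly_monom poly_monom)
    moreover have "real_of_int n2 < t"
      using t(1) pos2 p(1) prime_gt_1_nat[of p] by (simp add: n2)
    ultimately have le: "padic_val_point p (n, m) \<le> padic_val_point p (n2, m2)"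
      using vis[of "of_int n2" "(n2, m2)"] pos2 by simp
    have "\<not> is_unit (int p)" using pp(1) not_prime_unit by blast
    then have "multiplicity (int p) n = Suc (multiplicity (int p) n2)"
      using pp pos2 by (simp add: n2 multiplicity_times_same)
    moreover from \<open>\<not> is_unit (int p)\<close> have "multiplicity (int p) m = d + multiplicity (int p) m2"
      using pp pos2 by (simp add: m2 prime_elem_multiplicity_mult_distrib multiplicity_same_power)
    ultimately show False
      using le assms pos2 by (auto simp: padic_val_point_def padic_val_def min_def split: if_splits)
  qed
  then show ?thesis using p by blast
qed

lemma points_up_to_quadrant:
  "points_up_to {Q. fst Q > 0 \<and> snd Q > 0} X = {1..int (nat \<lfloor>X\<rfloor>)} \<times> {1..int (nat \<lfloor>X\<rfloor>)}"
proof (intro set_eqI)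
  fix Q :: "int \<times> int"
  show "Q \<in> points_up_to {Q. fst Q > 0 \<and> snd Q > 0} X \<longleftrightarrow> Q \<in> {1..int (nat \<lfloor>X\<rfloor>)} \<times> {1..int (nat \<lfloor>X\<rfloor>)}"
    by (cases Q) (auto simp: points_up_to_def le_floor_iff max_def split: if_splits; linarith)
qed

section \<open>The local defect set\<close>

text \<open>The intersection over the primes is not empty, so visibility at 2 already puts the point on a
  branch.\<close>
lemma local_defect_subset_branch_locus: "local_defect_set P \<subseteq> branch_locus P"
proof
  fix Q assume "Q \<in> local_defect_set P"
  then have "Q \<in> padically_visible 2 P" unfolding local_defect_set_def using two_is_prime_nat by blast
  then show "Q \<in> branch_locus P" unfolding padically_visible_def branch_locus_def by blast
qed

lemma local_defect_set_monomial_empty: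
  assumes "d \<ge> 1"
  shows "local_defect_set (monom 1 d) = {}"
proof (rule ccontr)
  assume "\<not> ?thesis"
  then obtain Q where Q: "Q \<in> local_defect_set (monom 1 d)" by blast
  then have B: "Q \<in> branch_locus (monom 1 d)" using local_defect_subset_branch_locus by blast
  have "branch_locus (monom (1::int) d) = {Q. fst Q > 0 \<and> snd Q > 0}"
    by (rule branch_locus_eq_quadrant) (simp add: poly_monom)
  then have "snd Q > 0" using B by simp
  moreover obtain s where "0 < s" "s < fst Q" "fst Q ^ d dvd snd Q * s ^ d"
    using hidden_of_not_globally_visible[OF B] Q
    unfolding local_defect_set_def by (auto simp: poly_monom)
  ultimately obtain p where "prime p" "(fst Q, snd Q) \<notin> padically_visible p (monom 1 d)"
    using monomial_hidden_not_padically_visible assms by blast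
  then show False using Q unfolding local_defect_set_def by auto
qed

theorem theorem5p3:
  fixes P :: "int poly"
  assumes "degree P \<ge> 1"
    and "lead_coeff P > 0"
    and "\<And>i. coeff P i \<ge> 0"
    and "coeff P 0 = 0"
    and "content P = 1"
  shows "density_zero_relative (local_defect_set P) (branch_locus P)"
proof (cases "P = monom (lead_coeff P) (degree P)")
  case True
  have "[:c:] dvd monom c n" for c :: int and n by (simp add: const_poly_dvd_iff)
  from this[of "lead_coeff P" "degree P"] have "[:lead_coeff P:] dvd P"
    unfolding True[symmetric] .
  then have "lead_coeff P dvd 1" unfolding const_poly_dvd_iff_dvd_content assms(5) .
  then have "lead_coeff P = 1" using assms(2) by simp
  then have "P = monom 1 (degree P)" using True by simp
  then have "local_defect_set P = {}" using local_defect_set_monomial_empty[OF assms(1)] by simp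
  then show ?thesis by (simp add: density_zero_relative_def points_up_to_def)
next
  case False
  define E where "E = (\<lambda>N. {(n, m) \<in> {1..int N} \<times> {1..int N}.
    \<exists>s. 0 < s \<and> s < n \<and> poly P n dvd m * poly P s})"
  have deg: "degree P \<ge> 2"
  proof (rule ccontr)
    assume "\<not> degree P \<ge> 2"
    then have d: "degree P = 1" using assms(1) by simp
    have "coeff P i = coeff (monom (lead_coeff P) (degree P)) i" for i
      using assms(4) d coeff_eq_0[of P i] by (cases "i = 0"; cases "i = 1") auto
    then show False using False poly_eqI by blast
  qed
  have P0: "poly P 0 = 0" using assms(4) by (simp add: poly_0_coeff_0)
  have quadrant: "branch_locus P = {Q. fst Q > 0 \<and> snd Q > 0}"
    using poly_strict_mono_nonneg_coeffs[OF assms(1-3), of 0] P0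
    by (intro branch_locus_eq_quadrant) auto
  let ?N = "\<lambda>X. nat \<lfloor>X\<rfloor>"
  have sub: "points_up_to (local_defect_set P) X \<subseteq> E (?N X)" for X
  proof
    fix Q assume "Q \<in> points_up_to (local_defect_set P) X"
    then have Q: "Q \<in> local_defect_set P" and "Q \<in> points_up_to (branch_locus P) X"
      using local_defect_subset_branch_locus by (auto simp: points_up_to_def)
    then have box: "Q \<in> {1..int (?N X)} \<times> {1..int (?N X)}"
      unfolding quadrant points_up_to_quadrant by blast
    have "Q \<in> branch_locus P" using Q local_defect_subset_branch_locus by blast
    moreover have "Q \<notin> globally_visible P" using Q by (simp add: local_defect_set_def)
    ultimately obtain s where "0 < s" "s < fst Q" "poly P (fst Q) dvd snd Q * poly P s"
      using hidden_of_not_globally_visible by blast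
    then show "Q \<in> E (?N X)" using box by (auto simp: E_def)
  qed
  have finE: "finite (E N)" for N
    by (rule finite_subset[of _ "{1..int N} \<times> {1..int N}"]) (auto simp: E_def)
  have N_lim: "filterlim ?N sequentially at_top"
    by (rule filterlim_compose[OF filterlim_nat_sequentially filterlim_floor_sequentially])
  have "((\<lambda>X. real (card (points_up_to (local_defect_set P) X)) /
      real (card (points_up_to (branch_locus P) X))) \<longlongrightarrow> 0) at_top"
  proof (rule tendstoI)
    fix e :: real assume e: "e > 0"
    have "\<forall>\<^sub>F N in sequentially. real (card (E N)) \<le> e / 2 * (real N)\<^sup>2"
      unfolding E_def using e by (intro nonmonomial_hidden_density_zero deg assms False) auto
    then have "\<forall>\<^sub>F N in sequentially. real (card (E N)) / (real N)\<^sup>2 < e"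
      using eventually_gt_at_top[of 0]
    proof eventually_elim
      case (elim N)
      then have "real (card (E N)) / (real N)\<^sup>2 \<le> e / 2" by (simp add: pos_divide_le_eq)
      then show ?case using e by linarith
    qed
    then have "\<forall>\<^sub>F X in at_top. real (card (E (?N X))) / (real (?N X))\<^sup>2 < e"
      using N_lim by (rule eventually_compose_filterlim)
    then show "\<forall>\<^sub>F X in at_top. dist (real (card (points_up_to (local_defect_set P) X)) /
      real (card (points_up_to (branch_locus P) X))) 0 < e"
    proof eventually_elim
      case (elim X)
      have "card (points_up_to (branch_locus P) X) = (?N X)\<^sup>2"
        unfolding quadrant points_up_to_quadrant by (simp add: card_cartesian_product power2_eq_square)
      moreover have "card (points_up_to (local_defect_set P) X) \<le> card (E (?N X))"
        using sub finE by (intro card_mono)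
      ultimately have "real (card (points_up_to (local_defect_set P) X)) /
          real (card (points_up_to (branch_locus P) X)) \<le> real (card (E (?N X))) / (real (?N X))\<^sup>2"
        by (simp add: divide_right_mono)
      then show ?case using elim by simp
    qed
  qed
  then show ?thesis unfolding density_zero_relative_def using local_defect_subset_branch_locus by blast
qed

end
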